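(* Let $k$ be a field of characteristic zero, $N\ge 2$, and let $\mathcal{C}\subset S_N$ be the conjugacy class of 2-cycles $(ij)=(ji)$, $i\neq j$. The quadratic exterior algebra $\Lambda_N=\Lambda_{quad}(S_N)$ for the class $\mathcal{C}$ is the associative unital $k$-algebra with generators $\{e_{(ij)}\}$ labelled by the 2-cycles (so $e_{(ij)}=e_{(ji)}$) and relations $$(i)\quad e_{(ij)}^2=0,\qquad (ii)\quad e_{(ij)}e_{(km)}+e_{(km)}e_{(ij)}=0,$$ $$(iii)\quad e_{(ij)}e_{(jk)}+e_{(jk)}e_{(ik)}+e_{(ik)}e_{(ij)}=0,$$ where $i,j,k,m\in\{1,\dots,N\}$ are distinct.
   Context: For a finite group $G$ and a conjugacy class $\mathcal{C}\subset G\setminus\{e\}$, let $\Lambda^1=k\mathcal{C}$ be the vector space with basis $\{e_a\mid a\in\mathcal{C}\}$, with braiding $\Psi:\Lambda^1\otimes\Lambda^1\to\Lambda^1\otimes\Lambda^1$, $\Psi(e_a\otimes e_b)=e_{aba^{-1}}\otimes e_a$. The quadratic exterior algebra (of left-invariant differential forms) is $\Lambda_{quad}=T\Lambda^1/\langle\ker(\mathrm{id}-\Psi)\rangle$, the quotient of the tensor algebra by the two-sided ideal generated by $\ker(\mathrm{id}-\Psi)\subset\Lambda^1\otimes\Lambda^1$. *)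

theory Defs
  imports
    "HOL-Algebra.Sym_Groups"
    "HOL-Algebra.QuotRing"
    "HOL-Algebra.Module"
    "HOL-Library.Poly_Mapping"
begin

section \<open>Associative unital algebras over a field type\<close>

text \<open>
  An algebra is a \<^type>\<open>module\<close> record: a (not necessarily commutative) ring with
  a scalar multiplication.
\<close>

definition algebra_iso ::
    "('k, 'a, 'm) module_scheme \<Rightarrow> ('k, 'b, 'n) module_scheme \<Rightarrow> ('a \<Rightarrow> 'b) set"
  where "algebra_iso A B =
    {h \<in> ring_iso A B. \<forall>c. \<forall>x\<in>carrier A. h (c \<odot>\<^bsub>A\<^esub> x) = c \<odot>\<^bsub>B\<^esub> h x}"

text \<open>
  The scalar multiplication on cosets is defined in the style of \<^const>\<open>rcoset_mult\<close>;
  \<open>quotient_algebra_smult\<close> below gives the usual description on representatives.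
\<close>

definition quotient_algebra :: "('k, 'a, 'm) module_scheme \<Rightarrow> 'a set \<Rightarrow> ('k, 'a set) module"
  where "quotient_algebra A I =
    ring.extend (A Quot I) (module.fields (\<lambda>c X. \<Union>x\<in>X. I +>\<^bsub>A\<^esub> (c \<odot>\<^bsub>A\<^esub> x)))"


section \<open>The tensor algebra of a space with basis\<close>

datatype 'a free_monoid = Word (letters: "'a list")

instantiation free_monoid :: (type) monoid_add
begin

definition "0 = Word []"
definition "u + v = Word (letters u @ letters v)"

instance
  by standard (simp_all add: zero_free_monoid_def plus_free_monoid_def)

end

text \<open>
  For the space \<open>kX\<close> with basis \<open>X\<close>, the \<open>n\<close>-th tensor power has as basis the
  words \<open>x\<^sub>1 \<otimes> \<dots> \<otimes> x\<^sub>n\<close> of length \<open>n\<close> over \<open>X\<close>, and the product of the tensor algebra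
  concatenates words.  An element is given by its finitely supported coefficients, and
  the product of \<^type>\<open>poly_mapping\<close> is convolution over the monoid of words.
  This is also the free associative unital algebra on the set \<open>X\<close>.
\<close>

definition tensor_algebra :: "'a set \<Rightarrow> ('k::field, 'a free_monoid \<Rightarrow>\<^sub>0 'k) module"
  where "tensor_algebra X =
    \<lparr>carrier = {t. \<forall>w\<in>Poly_Mapping.keys t. set (letters w) \<subseteq> X},
     mult = (*), one = 1, zero = 0, add = (+),
     smult = (\<lambda>c t. Poly_Mapping.map ((*) c) t)\<rparr>"

definition tensor_power :: "'a set \<Rightarrow> nat \<Rightarrow> ('a free_monoid \<Rightarrow>\<^sub>0 'k::field) set"
  where "tensor_power X n =
    {t \<in> carrier (tensor_algebra X). \<forall>w\<in>Poly_Mapping.keys t. length (letters w) = n}"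

definition basis_vec :: "'a \<Rightarrow> 'a free_monoid \<Rightarrow>\<^sub>0 'k::field"
  where "basis_vec a = Poly_Mapping.single (Word [a]) 1"


section \<open>The quadratic exterior algebra of a finite group with a conjugacy class\<close>

text \<open>
  The space \<open>\<Lambda>\<^sup>1 \<otimes> \<Lambda>\<^sup>1\<close> is \<open>tensor_power C 2\<close>, in which \<open>e\<^sub>a \<otimes> e\<^sub>b\<close> is the product
  \<open>basis_vec a * basis_vec b\<close>; see \<open>braiding_basis\<close> for the values on this basis.
\<close>

definition braiding ::
    "('g, 'm) monoid_scheme \<Rightarrow> 'g set \<Rightarrow> ('g free_monoid \<Rightarrow>\<^sub>0 'k::field) \<Rightarrow> ('g free_monoid \<Rightarrow>\<^sub>0 'k)"
  where "braiding G C t =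
    (\<Sum>a\<in>C. \<Sum>b\<in>C. Poly_Mapping.map ((*) (Poly_Mapping.lookup t (Word [a, b])))
       (basis_vec (a \<otimes>\<^bsub>G\<^esub> b \<otimes>\<^bsub>G\<^esub> inv\<^bsub>G\<^esub> a) * basis_vec a))"

definition braiding_kernel ::
    "('g, 'm) monoid_scheme \<Rightarrow> 'g set \<Rightarrow> ('g free_monoid \<Rightarrow>\<^sub>0 'k::field) set"
  where "braiding_kernel G C = {t \<in> tensor_power C 2. t - braiding G C t = 0}"

definition quad_ideal ::
    "('g, 'm) monoid_scheme \<Rightarrow> 'g set \<Rightarrow> ('g free_monoid \<Rightarrow>\<^sub>0 'k::field) set"
  where "quad_ideal G C = genideal (tensor_algebra C) (braiding_kernel G C)"

definition Lambda_quad ::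
    "('g, 'm) monoid_scheme \<Rightarrow> 'g set \<Rightarrow> ('k::field, ('g free_monoid \<Rightarrow>\<^sub>0 'k) set) module"
  where "Lambda_quad G C = quotient_algebra (tensor_algebra C) (quad_ideal G C)"

definition form_class ::
    "('g, 'm) monoid_scheme \<Rightarrow> 'g set \<Rightarrow> 'g \<Rightarrow> ('g free_monoid \<Rightarrow>\<^sub>0 'k::field) set"
  where "form_class G C a = quad_ideal G C +>\<^bsub>tensor_algebra C\<^esub> basis_vec a"


section \<open>Algebras given by generators and relations\<close>

text \<open>
  The parameter \<open>R\<close> is a set of relators in the free algebra on \<open>X\<close>, each standing for
  the relation that it vanishes.
\<close>

definition presented_algebra ::
    "'a set \<Rightarrow> ('a free_monoid \<Rightarrow>\<^sub>0 'k::field) set \<Rightarrow> ('k, ('a free_monoid \<Rightarrow>\<^sub>0 'k) set) module"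
  where "presented_algebra X R =
    quotient_algebra (tensor_algebra X) (genideal (tensor_algebra X) R)"

definition presented_gen ::
    "'a set \<Rightarrow> ('a free_monoid \<Rightarrow>\<^sub>0 'k::field) set \<Rightarrow> 'a \<Rightarrow> ('a free_monoid \<Rightarrow>\<^sub>0 'k) set"
  where "presented_gen X R a =
    genideal (tensor_algebra X) R +>\<^bsub>tensor_algebra X\<^esub> basis_vec a"


section \<open>The symmetric group with its class of 2-cycles\<close>

definition two_cycles :: "nat \<Rightarrow> (nat \<Rightarrow> nat) set"
  where "two_cycles N = {transpose i j | i j. i \<in> {1..N} \<and> j \<in> {1..N} \<and> i \<noteq> j}"

abbreviation e_cycle :: "nat \<Rightarrow> nat \<Rightarrow> (nat \<Rightarrow> nat) free_monoid \<Rightarrow>\<^sub>0 'k::field"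
  where "e_cycle i j \<equiv> basis_vec (transpose i j)"

definition cycle_relators :: "nat \<Rightarrow> ((nat \<Rightarrow> nat) free_monoid \<Rightarrow>\<^sub>0 'k::field) set"
  where "cycle_relators N =
    {e_cycle i j * e_cycle i j | i j. {i, j} \<subseteq> {1..N} \<and> distinct [i, j]}
    \<union> {e_cycle i j * e_cycle k m + e_cycle k m * e_cycle i j | i j k m.
         {i, j, k, m} \<subseteq> {1..N} \<and> distinct [i, j, k, m]}
    \<union> {e_cycle i j * e_cycle j k + e_cycle j k * e_cycle i k + e_cycle i k * e_cycle i j | i j k.
         {i, j, k} \<subseteq> {1..N} \<and> distinct [i, j, k]}"


section \<open>Basic facts\<close>

lemma ring_tensor_algebra:
  "ring (tensor_algebra X :: ('k::field, 'a free_monoid \<Rightarrow>\<^sub>0 'k) module)" (is "ring ?T")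
proof (rule ringI)
  show "abelian_group ?T"
  proof (rule abelian_groupI, goal_cases)
    case (1 x y)
    then show ?case
      using Poly_Mapping.keys_add[of x y] by (auto simp: tensor_algebra_def)
  next
    case (6 x)
    then show ?case
      by (intro bexI[of _ "- x"]) (simp_all add: tensor_algebra_def)
  qed (simp_all add: tensor_algebra_def add_ac)
  show "Group.monoid ?T"
  proof (rule monoidI)
    fix x y assume *: "x \<in> carrier ?T" "y \<in> carrier ?T"
    show "x \<otimes>\<^bsub>?T\<^esub> y \<in> carrier ?T"
      using * keys_mult[of x y]
      by (fastforce simp: tensor_algebra_def plus_free_monoid_def)
  qed (auto simp: tensor_algebra_def mult.assoc zero_free_monoid_def)
qed (auto simp: tensor_algebra_def distrib_left distrib_right)

lemma basis_vec_mult_basis_vec: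
  "basis_vec a * basis_vec b = Poly_Mapping.single (Word [a, b]) 1"
  by (simp add: basis_vec_def mult_single plus_free_monoid_def)

lemma braiding_basis:
  assumes "finite C" "a \<in> C" "b \<in> C"
  shows "braiding G C (basis_vec a * basis_vec b) =
    basis_vec (a \<otimes>\<^bsub>G\<^esub> b \<otimes>\<^bsub>G\<^esub> inv\<^bsub>G\<^esub> a) * basis_vec a"
proof -
  have "braiding G C (basis_vec a * basis_vec b) =
    (\<Sum>a'\<in>C. \<Sum>b'\<in>C. if a' = a then if b' = b then
        basis_vec (a \<otimes>\<^bsub>G\<^esub> b \<otimes>\<^bsub>G\<^esub> inv\<^bsub>G\<^esub> a) * basis_vec a else 0 else 0)"
    unfolding braiding_def
    by (intro sum.cong refl)
      (auto simp: basis_vec_mult_basis_vec lookup_single mult_map_scale_conv_mult when_def)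
  also have "\<dots> = (\<Sum>a'\<in>C. if a' = a then
        (\<Sum>b'\<in>C. if b' = b then basis_vec (a \<otimes>\<^bsub>G\<^esub> b \<otimes>\<^bsub>G\<^esub> inv\<^bsub>G\<^esub> a) * basis_vec a else 0) else 0)"
    by (intro sum.cong) auto
  finally show ?thesis
    using assms by simp
qed

lemma braiding_linear:
  fixes s t :: "'a free_monoid \<Rightarrow>\<^sub>0 'b::field"
  shows "braiding G C (s + t) = braiding G C s + braiding G C t"
    and "braiding G C (Poly_Mapping.map ((*) c) t) = Poly_Mapping.map ((*) c) (braiding G C t)"
proof -
  show "braiding G C (s + t) = braiding G C s + braiding G C t"
    unfolding braiding_def mult_map_scale_conv_mult
    by (simp add: lookup_add single_add distrib_right sum.distrib)
  have *: "Poly_Mapping.lookup (Poly_Mapping.map ((*) c) t) w = c * Poly_Mapping.lookup t w" for w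
    by (simp add: Poly_Mapping.map.rep_eq when_def)
  have **: "Poly_Mapping.map ((*) (c * d)) u = Poly_Mapping.map ((*) c) (Poly_Mapping.map ((*) d) u)"
    for d and u :: "'a free_monoid \<Rightarrow>\<^sub>0 'b"
    by (rule poly_mapping_eqI) (simp add: Poly_Mapping.map.rep_eq when_def mult.assoc)
  show "braiding G C (Poly_Mapping.map ((*) c) t) = Poly_Mapping.map ((*) c) (braiding G C t)"
    unfolding braiding_def * ** by (simp add: mult_map_scale_conv_mult sum_distrib_left)
qed

lemma quotient_algebra_smult:
  assumes I: "ideal I (tensor_algebra X)" and x: "x \<in> carrier (tensor_algebra X)"
  shows "c \<odot>\<^bsub>quotient_algebra (tensor_algebra X) I\<^esub> (I +>\<^bsub>tensor_algebra X\<^esub> x) =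
    I +>\<^bsub>tensor_algebra X\<^esub> (c \<odot>\<^bsub>tensor_algebra X\<^esub> x)"
proof -
  let ?T = "tensor_algebra X :: ('b, 'a free_monoid \<Rightarrow>\<^sub>0 'b) module"
  interpret ideal I ?T by (rule I)
  let ?c = "Poly_Mapping.single 0 c :: 'a free_monoid \<Rightarrow>\<^sub>0 'b"
  have c: "?c \<in> carrier ?T"
    by (auto simp: tensor_algebra_def zero_free_monoid_def)
  have sm: "c \<odot>\<^bsub>?T\<^esub> y = ?c \<otimes>\<^bsub>?T\<^esub> y" for y
    by (simp add: tensor_algebra_def mult_map_scale_conv_mult)
  have eq: "I +>\<^bsub>?T\<^esub> (c \<odot>\<^bsub>?T\<^esub> y) = I +>\<^bsub>?T\<^esub> (c \<odot>\<^bsub>?T\<^esub> x)" if "y \<in> I +>\<^bsub>?T\<^esub> x" for y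
  proof -
    from that obtain i where i: "i \<in> I" "y = i \<oplus>\<^bsub>?T\<^esub> x"
      by (auto simp: a_r_coset_def')
    have "c \<odot>\<^bsub>?T\<^esub> y = (?c \<otimes>\<^bsub>?T\<^esub> i) \<oplus>\<^bsub>?T\<^esub> (c \<odot>\<^bsub>?T\<^esub> x)"
      using i c x a_Hcarr by (simp add: sm r_distr)
    moreover have "?c \<otimes>\<^bsub>?T\<^esub> i \<in> I"
      using i c by (simp add: I_l_closed)
    ultimately have "c \<odot>\<^bsub>?T\<^esub> y \<in> I +>\<^bsub>?T\<^esub> (c \<odot>\<^bsub>?T\<^esub> x)"
      by (auto simp: a_r_coset_def')
    then show ?thesis
      using a_repr_independence'[of "c \<odot>\<^bsub>?T\<^esub> y" "c \<odot>\<^bsub>?T\<^esub> x"] c x by (simp add: sm)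
  qed
  have "x \<in> I +>\<^bsub>?T\<^esub> x"
    using a_rcos_self[OF x] .
  then have "(\<Union>y\<in>I +>\<^bsub>?T\<^esub> x. I +>\<^bsub>?T\<^esub> (c \<odot>\<^bsub>?T\<^esub> y)) = I +>\<^bsub>?T\<^esub> (c \<odot>\<^bsub>?T\<^esub> x)"
    using eq by blast
  then show ?thesis
    by (simp add: quotient_algebra_def ring.defs module.defs)
qed

lemma conj_transpose_sym_group:
  assumes "g permutes {1..N}"
  shows "g \<otimes>\<^bsub>sym_group N\<^esub> transpose p q \<otimes>\<^bsub>sym_group N\<^esub> inv\<^bsub>sym_group N\<^esub> g =
    transpose (g p) (g q)"
proof -
  have "inv\<^bsub>sym_group N\<^esub> g = inv' g"
  proof (rule group.inv_equality[OF sym_group_is_group])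
    show "inv' g \<otimes>\<^bsub>sym_group N\<^esub> g = \<one>\<^bsub>sym_group N\<^esub>"
      using permutes_inv_o(2)[OF assms] by (simp add: sym_group_def)
  qed (use assms permutes_inv in \<open>auto simp: sym_group_def\<close>)
  moreover have "g (transpose p q (inv' g x)) = transpose (g p) (g q) x" for x
    using permutes_inverses[OF assms] by (metis transpose_apply_first transpose_apply_other
        transpose_apply_second)
  ultimately show ?thesis
    by (auto simp: sym_group_def fun_eq_iff)
qed

lemma two_cycles_conjugacy_class:
  assumes "a \<in> two_cycles N"
  shows "two_cycles N =
    {g \<otimes>\<^bsub>sym_group N\<^esub> a \<otimes>\<^bsub>sym_group N\<^esub> inv\<^bsub>sym_group N\<^esub> g | g. g \<in> carrier (sym_group N)}"
proof -
  from assms obtain p q where pq: "a = transpose p q" "p \<in> {1..N}" "q \<in> {1..N}" "p \<noteq> q"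
    by (auto simp: two_cycles_def)
  have conj: "g \<otimes>\<^bsub>sym_group N\<^esub> a \<otimes>\<^bsub>sym_group N\<^esub> inv\<^bsub>sym_group N\<^esub> g = transpose (g p) (g q)"
    if "g permutes {1..N}" for g
    using conj_transpose_sym_group[OF that] pq by simp
  have "transpose (g p) (g q) \<in> two_cycles N" if "g permutes {1..N}" for g
    using pq permutes_in_image[OF that] injD[OF permutes_inj[OF that], of p q]
    unfolding two_cycles_def by blast
  moreover have "\<exists>g. g permutes {1..N} \<and> b = transpose (g p) (g q)" if b: "b \<in> two_cycles N" for b
  proof -
    from b obtain i j where ij: "b = transpose i j" "i \<in> {1..N}" "j \<in> {1..N}" "i \<noteq> j"
      by (auto simp: two_cycles_def)
    define r where "r = transpose p i q"
    have r: "r \<in> {1..N}" "r \<noteq> i"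
      using pq ij by (auto simp: r_def transpose_def)
    have "transpose r j \<circ> transpose p i permutes {1..N}"
      using r pq ij by (intro permutes_compose permutes_swap_id)
    moreover have "(transpose r j \<circ> transpose p i) p = i" "(transpose r j \<circ> transpose p i) q = j"
      using r ij by (simp_all add: r_def[symmetric] transpose_apply_other)
    ultimately show ?thesis
      using ij by metis
  qed
  ultimately have "two_cycles N = {transpose (g p) (g q) | g. g permutes {1..N}}"
    by blast
  also have "\<dots> = {g \<otimes>\<^bsub>sym_group N\<^esub> a \<otimes>\<^bsub>sym_group N\<^esub> inv\<^bsub>sym_group N\<^esub> g | g.
      g \<in> carrier (sym_group N)}"
    unfolding sym_group_carrier by (intro Collect_cong ex_cong1) (use conj in metis)
  finally show ?thesis .
qed

end

theory Submission
  imports Defs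
begin

text \<open>
  On the basis \<open>e\<^sub>a \<otimes> e\<^sub>b\<close> the braiding is a permutation all of whose orbits have length
  1, 2 or 3, and the orbit sums are the relators (i), (ii) and (iii).  Hence \<open>\<Psi>\<^sup>6 = id\<close>, and a
  fixed vector \<open>t\<close> is the average of \<open>t, \<Psi> t, \<dots>, \<Psi>\<^sup>5 t\<close>; expanding \<open>t\<close> in the basis turns this
  average into a combination of relators.  So \<open>ker (id - \<Psi>)\<close> and the relators generate the
  same ideal, and the two quotients coincide.
\<close>

section \<open>Tensors of degree two and the braiding on index pairs\<close>

definition braid_pair :: "('g, 'm) monoid_scheme \<Rightarrow> 'g \<times> 'g \<Rightarrow> 'g \<times> 'g"
  where "braid_pair G p = (fst p \<otimes>\<^bsub>G\<^esub> snd p \<otimes>\<^bsub>G\<^esub> inv\<^bsub>G\<^esub> fst p, fst p)"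

definition basis_pair :: "'a \<times> 'a \<Rightarrow> 'a free_monoid \<Rightarrow>\<^sub>0 'k::field"
  where "basis_pair p = basis_vec (fst p) * basis_vec (snd p)"

lemma lookup_basis_pair:
  "Poly_Mapping.lookup (basis_pair p) w = (if w = Word [fst p, snd p] then 1 else 0)"
  by (auto simp: basis_pair_def basis_vec_mult_basis_vec lookup_single when_def)

lemma basis_pair_in_tensor_power:
  assumes "a \<in> C" "b \<in> C"
  shows "basis_vec a * basis_vec b \<in> tensor_power C 2"
  using assms
  by (simp add: basis_vec_mult_basis_vec tensor_power_def tensor_algebra_def)

lemma tensor_power_add:
  "s \<in> tensor_power C n \<Longrightarrow> t \<in> tensor_power C n \<Longrightarrow> s + t \<in> tensor_power C n"
  using Poly_Mapping.keys_add[of s t]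
  by (fastforce simp: tensor_power_def tensor_algebra_def)

lemma tensor_power_2_expansion:
  fixes t :: "'a free_monoid \<Rightarrow>\<^sub>0 'k::field"
  assumes "finite C" "t \<in> tensor_power C 2"
  shows "t = (\<Sum>p\<in>C \<times> C. Poly_Mapping.map ((*) (Poly_Mapping.lookup t (Word [fst p, snd p])))
    (basis_pair p))"
proof (rule poly_mapping_eqI)
  fix w
  have "Poly_Mapping.lookup (\<Sum>p\<in>C \<times> C. Poly_Mapping.map
      ((*) (Poly_Mapping.lookup t (Word [fst p, snd p]))) (basis_pair p)) w =
    (\<Sum>p\<in>C \<times> C. if w = Word [fst p, snd p] then Poly_Mapping.lookup t w else 0)"
    unfolding lookup_sum
    by (intro sum.cong refl) (auto simp: Poly_Mapping.map.rep_eq lookup_basis_pair when_def)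
  also have "\<dots> = Poly_Mapping.lookup t w"
  proof (cases "\<exists>p\<in>C \<times> C. w = Word [fst p, snd p]")
    case True
    then obtain q where q: "q \<in> C \<times> C" "w = Word [fst q, snd q]"
      by blast
    then have "(\<Sum>p\<in>C \<times> C. if w = Word [fst p, snd p] then Poly_Mapping.lookup t w else 0) =
      (\<Sum>p\<in>C \<times> C. if p = q then Poly_Mapping.lookup t w else 0)"
      by (intro sum.cong refl) (auto simp: prod_eq_iff)
    then show ?thesis
      using q assms by simp
  next
    \<comment> \<open>The support of a tensor of degree two consists of two-letter words over
      \<open>C\<close>, so at any other \<open>w\<close> both sides vanish.\<close>
    case False
    have "w \<notin> Poly_Mapping.keys t"
    proof
      assume "w \<in> Poly_Mapping.keys t"
      then have "set (letters w) \<subseteq> C" "length (letters w) = 2"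
        using assms by (auto simp: tensor_power_def tensor_algebra_def)
      with False show False
        by (cases w) (auto simp: length_Suc_conv numeral_2_eq_2)
    qed
    with False show ?thesis
      by (auto simp: in_keys_iff intro!: sum.neutral)
  qed
  finally show "Poly_Mapping.lookup t w = Poly_Mapping.lookup (\<Sum>p\<in>C \<times> C. Poly_Mapping.map
      ((*) (Poly_Mapping.lookup t (Word [fst p, snd p]))) (basis_pair p)) w"
    by simp
qed

text \<open>This replaces iteration of a linear map by iteration of a map on pairs of group
  elements.\<close>

lemma braiding_basis_pair:
  assumes "finite C" "p \<in> C \<times> C"
  shows "braiding G C (basis_pair p) = basis_pair (braid_pair G p)"
  using assms by (auto simp: basis_pair_def braid_pair_def braiding_basis)

lemma braiding_sum: "braiding G C (\<Sum>i\<in>A. f i) = (\<Sum>i\<in>A. braiding G C (f i))"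
proof (induction A rule: infinite_finite_induct)
  case (insert x A)
  then show ?case
    by (simp add: braiding_linear)
qed (simp_all add: braiding_def mult_map_scale_conv_mult)

text \<open>By linearity the powers of the braiding only move the basis vectors and leave the
  coefficients in place. Closure keeps every iterate in \<open>C \<times> C\<close>;
  \<open>braiding\<close> sends words outside it to 0.\<close>

lemma braiding_funpow_expansion:
  fixes c :: "'g \<times> 'g \<Rightarrow> 'k::field"
  assumes "finite C" and closed: "\<And>p. p \<in> C \<times> C \<Longrightarrow> braid_pair G p \<in> C \<times> C"
  shows "(braiding G C ^^ n) (\<Sum>p\<in>C \<times> C. Poly_Mapping.map ((*) (c p)) (basis_pair p)) =
    (\<Sum>p\<in>C \<times> C. Poly_Mapping.map ((*) (c p)) (basis_pair ((braid_pair G ^^ n) p)))"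
proof (induction n)
  case (Suc n)
  have "(braid_pair G ^^ n) p \<in> C \<times> C" if "p \<in> C \<times> C" for p
    using that by (induction n) (use closed in simp_all)
  with Suc show ?case
    using assms(1) by (auto simp: braiding_sum braiding_linear braiding_basis_pair intro!: sum.cong)
qed simp

section \<open>Ideals and averaging of fixed vectors\<close>

text \<open>An ideal here is an ideal of the underlying ring. It is also a subspace, since scaling
  by \<open>c\<close> is multiplication by the ring element \<open>Poly_Mapping.single 0 c\<close>,
  that is, \<open>c\<close> times the empty word.\<close>

lemma ideal_tensor_algebra_closed:
  assumes "ideal I (tensor_algebra X :: ('k::field, 'a free_monoid \<Rightarrow>\<^sub>0 'k) module)"
  shows "0 \<in> I" and "s \<in> I \<Longrightarrow> t \<in> I \<Longrightarrow> s + t \<in> I"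
    and "t \<in> I \<Longrightarrow> Poly_Mapping.map ((*) c) t \<in> I"
proof -
  interpret ideal I "tensor_algebra X :: ('k, 'a free_monoid \<Rightarrow>\<^sub>0 'k) module"
    by (rule assms)
  show "0 \<in> I"
    using additive_subgroup.zero_closed[OF is_additive_subgroup] by (simp add: tensor_algebra_def)
  show "s + t \<in> I" if "s \<in> I" "t \<in> I"
    using additive_subgroup.a_closed[OF is_additive_subgroup that] by (simp add: tensor_algebra_def)
  have "Poly_Mapping.single 0 c \<in> carrier (tensor_algebra X :: ('k, 'a free_monoid \<Rightarrow>\<^sub>0 'k) module)"
    by (simp add: tensor_algebra_def zero_free_monoid_def)
  then show "Poly_Mapping.map ((*) c) t \<in> I" if "t \<in> I"
    using I_l_closed[OF that] by (simp add: tensor_algebra_def mult_map_scale_conv_mult)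
qed

text \<open>The averaging argument for a general ideal: \<open>n\<close> times a fixed vector is the
  sum of its first \<open>n\<close> iterates, and collecting by basis pairs leaves a combination of
  the sums assumed to lie in \<open>I\<close>. Characteristic zero then allows division by
  \<open>n\<close>.\<close>

lemma braiding_fixed_in_ideal:
  fixes t :: "'g free_monoid \<Rightarrow>\<^sub>0 'k::field_char_0"
  assumes "finite C" and closed: "\<And>p. p \<in> C \<times> C \<Longrightarrow> braid_pair G p \<in> C \<times> C"
    and I: "ideal I (tensor_algebra C)" and "n > 0"
    and orbit: "\<And>p. p \<in> C \<times> C \<Longrightarrow> (\<Sum>i<n. basis_pair ((braid_pair G ^^ i) p)) \<in> I"
    and t: "t \<in> braiding_kernel G C"
  shows "t \<in> I"
proof -
  define c where "c p = Poly_Mapping.lookup t (Word [fst p, snd p])" for p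
  have sum_closed: "(\<Sum>p\<in>A. f p) \<in> I" if "\<And>p. p \<in> A \<Longrightarrow> f p \<in> I" for f and A :: "('g \<times> 'g) set"
    using that by (induction A rule: infinite_finite_induct) (auto intro: ideal_tensor_algebra_closed[OF I])
  have exp: "t = (\<Sum>p\<in>C \<times> C. Poly_Mapping.map ((*) (c p)) (basis_pair p))"
    unfolding c_def using t assms(1) by (intro tensor_power_2_expansion) (simp_all add: braiding_kernel_def)
  have fixed: "(braiding G C ^^ i) t = t" for i
    using t by (induction i) (simp_all add: braiding_kernel_def)
  have "of_nat n * t = (\<Sum>i<n. (braiding G C ^^ i) t)"
    by (simp add: fixed)
  also have "\<dots> = (\<Sum>i<n. \<Sum>p\<in>C \<times> C.
      Poly_Mapping.map ((*) (c p)) (basis_pair ((braid_pair G ^^ i) p)))"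
    by (subst exp) (simp add: braiding_funpow_expansion[OF assms(1) closed])
  also have "\<dots> = (\<Sum>p\<in>C \<times> C. Poly_Mapping.map ((*) (c p))
      (\<Sum>i<n. basis_pair ((braid_pair G ^^ i) p)))"
    by (subst sum.swap) (simp add: mult_map_scale_conv_mult sum_distrib_left)
  also have "\<dots> \<in> I"
    by (intro sum_closed ideal_tensor_algebra_closed(3)[OF I] orbit)
  finally have "Poly_Mapping.map ((*) (1 / of_nat n)) (of_nat n * t) \<in> I"
    by (rule ideal_tensor_algebra_closed(3)[OF I])
  also have "Poly_Mapping.map ((*) (1 / of_nat n)) (of_nat n * t) = t"
  proof -
    \<comment> \<open>The numeral lives in the convolution ring; rewritten as a scalar at the empty
      word, it cancels against \<open>1 / of_nat n\<close> in the field.\<close>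
    have "of_nat n = Poly_Mapping.single (0 :: 'g free_monoid) (of_nat n :: 'k)"
      by (induction n) (simp_all add: single_add)
    then show ?thesis
      using \<open>n > 0\<close> by (simp add: mult_map_scale_conv_mult mult.assoc[symmetric] mult_single
          del: single_of_nat)
  qed
  finally show ?thesis .
qed

section \<open>Conjugation of transpositions and orbits of pairs\<close>

lemma two_cyclesI: "i \<in> {1..N} \<Longrightarrow> j \<in> {1..N} \<Longrightarrow> i \<noteq> j \<Longrightarrow> transpose i j \<in> two_cycles N"
  by (auto simp: two_cycles_def)

lemma finite_two_cycles: "finite (two_cycles N)"
proof -
  have "two_cycles N \<subseteq> (\<lambda>(i, j). transpose i j) ` ({1..N} \<times> {1..N})"
    by (auto simp: two_cycles_def)
  then show ?thesis
    by (rule finite_subset) simp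
qed

lemma braid_pair_transpose:
  assumes "i \<in> {1..N}" "j \<in> {1..N}"
  shows "braid_pair (sym_group N) (transpose i j, transpose k m) =
    (transpose (transpose i j k) (transpose i j m), transpose i j)"
  using conj_transpose_sym_group[OF permutes_swap_id[OF assms]] by (simp add: braid_pair_def)

lemma braid_pair_two_cycles:
  assumes "p \<in> two_cycles N \<times> two_cycles N"
  shows "braid_pair (sym_group N) p \<in> two_cycles N \<times> two_cycles N"
proof -
  obtain i j k m where p: "p = (transpose i j, transpose k m)"
    and ij: "i \<in> {1..N}" "j \<in> {1..N}" "i \<noteq> j" and km: "k \<in> {1..N}" "m \<in> {1..N}" "k \<noteq> m"
    using assms by (auto simp: two_cycles_def)
  have "transpose i j k \<in> {1..N}" "transpose i j m \<in> {1..N}"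
    using ij km by (auto simp: transpose_def)
  \<comment> \<open>A transposition is an involution, hence injective.\<close>
  moreover have "transpose i j k \<noteq> transpose i j m"
    using km by (metis transpose_involutory)
  ultimately show ?thesis
    using ij by (simp add: p braid_pair_transpose two_cyclesI)
qed

lemma braid_pair_equal:
  assumes "{i, j} \<subseteq> {1..N}"
  shows "braid_pair (sym_group N) (transpose i j, transpose i j) = (transpose i j, transpose i j)"
  using assms by (simp add: braid_pair_transpose transpose_commute)

lemma braid_pair_disjoint:
  assumes "{i, j, k, m} \<subseteq> {1..N}" "distinct [i, j, k, m]"
  shows "braid_pair (sym_group N) (transpose i j, transpose k m) = (transpose k m, transpose i j)"
  using assms by (simp add: braid_pair_transpose transpose_apply_other)

lemma braid_pair_overlapping:
  assumes "{i, j, k} \<subseteq> {1..N}" "distinct [i, j, k]"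
  shows "braid_pair (sym_group N) (transpose i j, transpose j k) = (transpose i k, transpose i j)"
  using assms by (simp add: braid_pair_transpose transpose_apply_other)

text \<open>The supports of two transpositions share two, no or exactly one point. The three cases
  match the relator families (i), (ii) and (iii).\<close>

lemma two_cycles_pair_cases:
  assumes "a \<in> two_cycles N" "b \<in> two_cycles N"
  obtains (equal) i j where "{i, j} \<subseteq> {1..N}" "distinct [i, j]" "a = transpose i j" "b = transpose i j"
  | (disjoint) i j k m where "{i, j, k, m} \<subseteq> {1..N}" "distinct [i, j, k, m]"
      "a = transpose i j" "b = transpose k m"
  | (overlapping) i j k where "{i, j, k} \<subseteq> {1..N}" "distinct [i, j, k]"
      "a = transpose i j" "b = transpose j k"
proof -
  obtain i j k m where a: "a = transpose i j" "i \<in> {1..N}" "j \<in> {1..N}" "i \<noteq> j"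
    and b: "b = transpose k m" "k \<in> {1..N}" "m \<in> {1..N}" "k \<noteq> m"
    using assms by (auto simp: two_cycles_def)
  have a': "a = transpose j i" and b': "b = transpose m k"
    using a b by (simp_all add: transpose_commute)
  \<comment> \<open>With a single common point, \<open>a'\<close> and \<open>b'\<close> rewrite the
    transpositions where necessary so that this point comes second in \<open>a\<close> and first in
    \<open>b\<close>.\<close>
  consider "i = k" "j = m" | "i = m" "j = k" | "i = k" "j \<noteq> m" | "i = m" "j \<noteq> k"
    | "j = k" "i \<noteq> m" | "j = m" "i \<noteq> k" | "distinct [i, j, k, m]"
    using a b by auto
  then show thesis
  proof cases
    case 1 with a b show ?thesis by (intro equal[of i j]) auto
  next
    case 2 with a b b' show ?thesis by (intro equal[of i j]) auto
  next
    case 3 with a a' b show ?thesis by (intro overlapping[of j i m]) auto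
  next
    case 4 with a a' b b' show ?thesis by (intro overlapping[of j i k]) auto
  next
    case 5 with a b show ?thesis by (intro overlapping[of i j m]) auto
  next
    case 6 with a b b' show ?thesis by (intro overlapping[of i j k]) auto
  next
    case 7 with a b show ?thesis by (intro disjoint[of i j k m]) auto
  qed
qed

text \<open>A single computation under the cyclic renamings of \<open>i\<close>, \<open>j\<close>,
  \<open>k\<close>, up to swapping the entries of a transposition. The three pairs form a 3-cycle,
  and their basis vectors are the summands of relator (iii).\<close>

lemma overlapping_braid_orbit:
  assumes "{i, j, k} \<subseteq> {1..N}" "distinct [i, j, k]"
  shows "braid_pair (sym_group N) (transpose i j, transpose j k) = (transpose i k, transpose i j)"
    and "braid_pair (sym_group N) (transpose i k, transpose i j) = (transpose j k, transpose i k)"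
    and "braid_pair (sym_group N) (transpose j k, transpose i k) = (transpose i j, transpose j k)"
  using braid_pair_overlapping[of i j k N] braid_pair_overlapping[of k i j N]
    braid_pair_overlapping[of j k i N] assms
  by (simp_all add: transpose_commute)

section \<open>Relators as orbit sums\<close>

text \<open>Each relator is the sum over a full orbit, so the braiding merely permutes its summands.
  This direction involves no division and holds over every field.\<close>

lemma cycle_relators_subset_kernel:
  "(cycle_relators N :: ((nat \<Rightarrow> nat) free_monoid \<Rightarrow>\<^sub>0 'k::field) set)
    \<subseteq> braiding_kernel (sym_group N) (two_cycles N)"
proof
  let ?\<Psi> = "braiding (sym_group N) (two_cycles N) ::
    ((nat \<Rightarrow> nat) free_monoid \<Rightarrow>\<^sub>0 'k) \<Rightarrow> ((nat \<Rightarrow> nat) free_monoid \<Rightarrow>\<^sub>0 'k)"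
  have \<Psi>: "?\<Psi> (basis_vec a * basis_vec b) = basis_vec c * basis_vec d"
    if "a \<in> two_cycles N" "b \<in> two_cycles N" "braid_pair (sym_group N) (a, b) = (c, d)" for a b c d
    using braiding_basis_pair[OF finite_two_cycles, of "(a, b)" N "sym_group N"] that
    by (simp add: basis_pair_def)
  fix r :: "(nat \<Rightarrow> nat) free_monoid \<Rightarrow>\<^sub>0 'k" assume "r \<in> cycle_relators N"
  then consider
    (equal) i j where "{i, j} \<subseteq> {1..N}" "distinct [i, j]" "r = e_cycle i j * e_cycle i j"
  | (disjoint) i j k m where "{i, j, k, m} \<subseteq> {1..N}" "distinct [i, j, k, m]"
      "r = e_cycle i j * e_cycle k m + e_cycle k m * e_cycle i j"
  | (overlapping) i j k where "{i, j, k} \<subseteq> {1..N}" "distinct [i, j, k]"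
      "r = e_cycle i j * e_cycle j k + e_cycle j k * e_cycle i k + e_cycle i k * e_cycle i j"
    unfolding cycle_relators_def by (elim UnE CollectE exE conjE) (rule that; assumption)+
  then show "r \<in> braiding_kernel (sym_group N) (two_cycles N)"
  proof cases
    case equal
    then have "transpose i j \<in> two_cycles N"
      by (auto intro: two_cyclesI)
    moreover from this have "?\<Psi> r = r"
      unfolding equal(3) by (intro \<Psi> braid_pair_equal equal(1))
    ultimately show ?thesis
      by (simp add: equal(3) braiding_kernel_def basis_pair_in_tensor_power)
  next
    case disjoint
    then have "transpose i j \<in> two_cycles N" "transpose k m \<in> two_cycles N"
      by (auto intro: two_cyclesI)
    moreover have "braid_pair (sym_group N) (transpose i j, transpose k m) = (transpose k m, transpose i j)"
      "braid_pair (sym_group N) (transpose k m, transpose i j) = (transpose i j, transpose k m)"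
      using disjoint by (auto intro!: braid_pair_disjoint)
    ultimately show ?thesis
      by (simp add: disjoint(3) braiding_kernel_def basis_pair_in_tensor_power tensor_power_add
          braiding_linear \<Psi>)
  next
    case overlapping
    then have "transpose i j \<in> two_cycles N" "transpose j k \<in> two_cycles N" "transpose i k \<in> two_cycles N"
      by (auto intro: two_cyclesI)
    then show ?thesis
      using overlapping_braid_orbit[OF overlapping(1,2)]
      by (simp add: overlapping(3) braiding_kernel_def basis_pair_in_tensor_power tensor_power_add
          braiding_linear \<Psi>)
  qed
qed

text \<open>Six is a common multiple of the orbit lengths 1, 2 and 3.\<close>

lemma braid_orbit_sum_in_ideal:
  fixes I :: "((nat \<Rightarrow> nat) free_monoid \<Rightarrow>\<^sub>0 'k::field) set"
  assumes I: "ideal I (tensor_algebra X)" and R: "cycle_relators N \<subseteq> I"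
    and p: "p \<in> two_cycles N \<times> two_cycles N"
  shows "(\<Sum>n<6. basis_pair ((braid_pair (sym_group N) ^^ n) p)) \<in> I"
proof -
  \<comment> \<open>Six iterates run through an orbit of length 3, 2 or 1 two, three or six times,
    so the sum is that multiple of a relator.\<close>
  have multiples: "s + s \<in> I" "s + s + s \<in> I" "s + s + s + s + s + s \<in> I" if "s \<in> I" for s
    using that by (simp_all add: ideal_tensor_algebra_closed(2)[OF I])
  have six: "{..<6::nat} = {0, 1, 2, 3, 4, 5}"
    by auto
  let ?B = "braid_pair (sym_group N)"
  have sum: "(\<Sum>n<6. basis_pair ((?B ^^ n) p)) = basis_pair p + basis_pair (?B p)
    + basis_pair (?B (?B p)) + basis_pair (?B (?B (?B p))) + basis_pair (?B (?B (?B (?B p))))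
    + basis_pair (?B (?B (?B (?B (?B p)))))"
    by (simp add: six eval_nat_numeral add.assoc)
  obtain a b where ab: "p = (a, b)" "a \<in> two_cycles N" "b \<in> two_cycles N"
    using p by auto
  show ?thesis
    using ab(2,3)
  proof (cases rule: two_cycles_pair_cases)
    case (equal i j)
    let ?r = "e_cycle i j * e_cycle i j :: (nat \<Rightarrow> nat) free_monoid \<Rightarrow>\<^sub>0 'k"
    have "?r \<in> cycle_relators N"
      using equal unfolding cycle_relators_def by blast
    then have "?r + ?r + ?r + ?r + ?r + ?r \<in> I"
      using R by (blast intro: multiples)
    then show ?thesis
      unfolding sum using equal by (simp add: ab(1) braid_pair_equal basis_pair_def)
  next
    case (disjoint i j k m)
    let ?r = "e_cycle i j * e_cycle k m + e_cycle k m * e_cycle i j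
      :: (nat \<Rightarrow> nat) free_monoid \<Rightarrow>\<^sub>0 'k"
    have "?r \<in> cycle_relators N"
      using disjoint unfolding cycle_relators_def by blast
    then have "?r + ?r + ?r \<in> I"
      using R by (blast intro: multiples)
    moreover have "?B (a, b) = (b, a)" "?B (b, a) = (a, b)"
      using disjoint by (auto intro!: braid_pair_disjoint)
    ultimately show ?thesis
      unfolding sum using disjoint(3,4) by (simp add: ab(1) basis_pair_def add_ac)
  next
    case (overlapping i j k)
    let ?r = "e_cycle i j * e_cycle j k + e_cycle j k * e_cycle i k + e_cycle i k * e_cycle i j
      :: (nat \<Rightarrow> nat) free_monoid \<Rightarrow>\<^sub>0 'k"
    have "?r \<in> cycle_relators N"
      using overlapping unfolding cycle_relators_def by blast
    then have "?r + ?r \<in> I"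
      using R by (blast intro: multiples)
    \<comment> \<open>The iterates meet the summands of the relator in the order 1, 3, 2, twice
      over; commutativity of addition reorders them.\<close>
    then show ?thesis
      unfolding sum using overlapping(3,4) overlapping_braid_orbit[OF overlapping(1,2)]
      by (simp add: ab(1) basis_pair_def add_ac)
  qed
qed

section \<open>Equality of the ideals and the isomorphism\<close>

text \<open>Both generating sets lie in the same tensor algebra, so it suffices that each is
  contained in the ideal generated by the other.\<close>

lemma genideal_cycle_relators:
  "genideal (tensor_algebra (two_cycles N)) (cycle_relators N) =
    (quad_ideal (sym_group N) (two_cycles N) :: ((nat \<Rightarrow> nat) free_monoid \<Rightarrow>\<^sub>0 'k::field_char_0) set)"
proof -
  let ?T = "tensor_algebra (two_cycles N) :: ('k, (nat \<Rightarrow> nat) free_monoid \<Rightarrow>\<^sub>0 'k) module"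
  let ?K = "braiding_kernel (sym_group N) (two_cycles N) :: ((nat \<Rightarrow> nat) free_monoid \<Rightarrow>\<^sub>0 'k) set"
  interpret ring ?T
    by (rule ring_tensor_algebra)
  have K: "?K \<subseteq> carrier ?T"
    by (auto simp: braiding_kernel_def tensor_power_def)
  have R: "cycle_relators N \<subseteq> carrier ?T"
    using cycle_relators_subset_kernel K by (rule subset_trans)
  have "genideal ?T (cycle_relators N) \<subseteq> genideal ?T ?K"
    using genideal_ideal[OF K] genideal_self[OF K] cycle_relators_subset_kernel[of N]
    by (intro genideal_minimal) auto
  \<comment> \<open>Averaging with \<open>n = 6\<close> is where characteristic zero enters: 6 must
    be invertible in the field.\<close>
  moreover have "?K \<subseteq> genideal ?T (cycle_relators N)"
    using braiding_fixed_in_ideal[OF finite_two_cycles braid_pair_two_cycles genideal_ideal[OF R], of 6]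
      braid_orbit_sum_in_ideal[OF genideal_ideal[OF R] genideal_self[OF R]]
    by auto
  then have "genideal ?T ?K \<subseteq> genideal ?T (cycle_relators N)"
    by (intro genideal_minimal genideal_ideal R)
  ultimately show ?thesis
    by (simp add: quad_ideal_def)
qed

theorem proposition3p1:
  fixes N :: nat
  assumes "N \<ge> 2"
  shows "\<exists>\<phi> \<in> algebra_iso
      (presented_algebra (two_cycles N) (cycle_relators N)
        :: ('k::field_char_0, ((nat \<Rightarrow> nat) free_monoid \<Rightarrow>\<^sub>0 'k) set) module)
      (Lambda_quad (sym_group N) (two_cycles N)).
    \<forall>a \<in> two_cycles N.
      \<phi> (presented_gen (two_cycles N) (cycle_relators N) a)
        = form_class (sym_group N) (two_cycles N) a"
proof (intro bexI[of _ id] ballI)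
  \<comment> \<open>Equal ideals give literally the same quotient algebra, with the same cosets as
    generators, so the identity serves as the isomorphism.\<close>
  show "id \<in> algebra_iso
      (presented_algebra (two_cycles N) (cycle_relators N)
        :: ('k, ((nat \<Rightarrow> nat) free_monoid \<Rightarrow>\<^sub>0 'k) set) module)
      (Lambda_quad (sym_group N) (two_cycles N))"
    by (simp add: algebra_iso_def presented_algebra_def Lambda_quad_def genideal_cycle_relators
        ring_iso_set_refl)
qed (simp add: presented_gen_def form_class_def genideal_cycle_relators)

end
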